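(* Let $n,m\in\mathbb N$, $1\le p\le q<\infty$, let $p'$ be the conjugate exponent of $p$, and let $m$ be even. Every regular linear operator $S:L_{p'}(G_{m,n}\times[n])\to L_{p'}(G_{m,n}\times\Sigma_n)$ satisfying $$D_{\mathrm{sgn}}^*S=\mathcal D_{q,\mathrm{long}}^*$$ has $\|S\|_{\mathrm{reg}}\ge n^{1/q}$, and equality is attained by some such $S$.
   Context: All spaces are real; $\mathbb N=\{1,2,\ldots\}$; $[n]=\{1,\ldots,n\}$; $p'=\infty$ when $p=1$. Let $G_{m,n}=(\mathbb Z/(2m\mathbb Z))^n$ and $\Sigma_n=\{-1,1\}^n$. Let $e_j$ be the $j$-th standard basis vector; additions in $G_{m,n}$ are modulo $2m$. For a finite nonempty set $\Omega$, a Banach space $Y$ and $1\le r<\infty$, $L_r(\Omega;Y)$ is the space of all maps $F:\Omega\to Y$ with $\|F\|_{L_r(\Omega;Y)}=\bigl(|\Omega|^{-1}\sum_{\omega\in\Omega}\|F(\omega)\|_Y^r\bigr)^{1/r}$; for $r=\infty$ the norm is the maximum of $\|F(\omega)\|_Y$. $L_r(\Omega)=L_r(\Omega;\mathbb R)$. For $g:G_{m,n}\times[n]\to\mathbb R$ and $h:G_{m,n}\times\Sigma_n\to\mathbb R$, define functions on $G_{m,n}$ by $$D_{\mathrm{long}}^*g(x)=\frac1n\sum_{j=1}^n\bigl(g(x-me_j,j)-g(x,j)\bigr),\qquad D_{\mathrm{sgn}}^*h(x)=2^{-n}\sum_{\varepsilon\in\Sigma_n}\bigl(h(x-\varepsilon,\varepsilon)-h(x,\varepsilon)\bigr),$$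 and $\mathcal D_{q,\mathrm{long}}^*=\frac{n^{1/q}}{m}D_{\mathrm{long}}^*$. (These are the adjoints, for the normalized finite-sum dualities, of $(D_{\mathrm{long}}f)(x,j)=f(x+me_j)-f(x)$, $(D_{\mathrm{sgn}}f)(x,\varepsilon)=f(x+\varepsilon)-f(x)$ and $\mathcal D_{q,\mathrm{long}}=\frac{n^{1/q}}mD_{\mathrm{long}}$.) For a linear operator $R:L_r(\Omega)\to L_r(\Omega')$ between such finite scalar spaces, $1\le r\le\infty$, its regular norm is $\|R\|_{\mathrm{reg}}=\sup_{N\ge1}\|R\otimes I_{\ell_\infty^N}\|$, where $R\otimes I_{\ell_\infty^N}:L_r(\Omega;\ell_\infty^N)\to L_r(\Omega';\ell_\infty^N)$ acts by the same scalar matrix as $R$ (i.e. coordinatewise), and the norm is the operator norm. $R$ is regular if this is finite (automatic here, since the sets are finite). *)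

theory Defs
  imports "HOL-Analysis.Analysis" "HOL-Library.Numeral_Type"
begin

text \<open>
  The sizes are carried by types: \<open>m\<close> is \<open>CARD('m)\<close>, \<open>n\<close> is \<open>CARD('n)\<close>, the index set \<open>[n]\<close>
  is \<open>'n\<close>, and \<open>'m bit0\<close> is the ring of integers modulo \<open>2 * CARD('m)\<close>. Hence addition in
  \<open>torus\<close> is coordinatewise addition modulo \<open>2m\<close>.
\<close>

type_synonym ('m, 'n) torus = "('m bit0, 'n) vec"

typedef pm_one = "{- 1, 1 :: int}"
  by blast

instance pm_one :: finite
proof
  have "(UNIV :: pm_one set) = Abs_pm_one ` {- 1, 1}"
    by (rule type_definition.univ[OF type_definition_pm_one])
  then show "finite (UNIV :: pm_one set)"
    by (metis finite.emptyI finite.insertI finite_imageI)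
qed

type_synonym 'n signs = "(pm_one, 'n) vec"

definition sign_shift :: "'n signs \<Rightarrow> ('m::finite, 'n::finite) torus" where
  "sign_shift \<epsilon> = (\<chi> i. of_int (Rep_pm_one (\<epsilon> $ i)))"

definition D_long_adj ::
  "real ^ (('m::finite, 'n::finite) torus \<times> 'n) \<Rightarrow> real ^ ('m, 'n) torus" where
  "D_long_adj g =
     (\<chi> x. (1 / real CARD('n)) *
           (\<Sum>j\<in>UNIV. g $ (x - axis j (of_nat CARD('m)), j) - g $ (x, j)))"

definition D_sgn_adj ::
  "real ^ (('m::finite, 'n::finite) torus \<times> 'n signs) \<Rightarrow> real ^ ('m, 'n) torus" where
  "D_sgn_adj h =
     (\<chi> x. (1 / 2 ^ CARD('n)) *
           (\<Sum>\<epsilon>\<in>UNIV. h $ (x - sign_shift \<epsilon>, \<epsilon>) - h $ (x, \<epsilon>)))"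

definition Dq_long_adj ::
  "real \<Rightarrow> real ^ (('m::finite, 'n::finite) torus \<times> 'n) \<Rightarrow> real ^ ('m, 'n) torus" where
  "Dq_long_adj q g = (real CARD('n) powr (1 / q) / real CARD('m)) *\<^sub>R D_long_adj g"

text \<open>
  The norm of \<open>L_r(\<Omega>; Y)\<close>, with \<open>\<Omega>\<close> a finite type carrying normalized counting measure. The norm
  of \<open>Y\<close> is an argument, since \<open>Y\<close> ranges over the spaces \<open>\<ell>_\<infinity>^N\<close> with \<open>N\<close> quantified
  inside the definition of the regular norm.
\<close>

definition L_norm :: "('y \<Rightarrow> real) \<Rightarrow> ereal \<Rightarrow> ('w::finite \<Rightarrow> 'y) \<Rightarrow> real" where
  "L_norm norm_Y r F =
     (if r = \<infinity> then Max (range (\<lambda>\<omega>. norm_Y (F \<omega>)))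
      else ((1 / real CARD('w)) * (\<Sum>\<omega>\<in>UNIV. norm_Y (F \<omega>) powr real_of_ereal r))
             powr (1 / real_of_ereal r))"

text \<open>
  A vector of \<open>\<ell>_\<infinity>^N\<close> is represented by a function on \<open>nat\<close> of which only the values at
  \<open>i < N\<close> matter; the coordinatewise extension of an operator respects this.
\<close>

definition linf_norm :: "nat \<Rightarrow> (nat \<Rightarrow> real) \<Rightarrow> real" where
  "linf_norm N v = Max ((\<lambda>i. \<bar>v i\<bar>) ` {..<N})"

definition coordinatewise ::
  "(real ^ 'a::finite \<Rightarrow> real ^ 'b::finite) \<Rightarrow> ('a \<Rightarrow> nat \<Rightarrow> real) \<Rightarrow> ('b \<Rightarrow> nat \<Rightarrow> real)" where
  "coordinatewise R F = (\<lambda>\<omega> i. R (\<chi> \<eta>. F \<eta> i) $ \<omega>)"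

definition tensor_linf_norm ::
  "ereal \<Rightarrow> (real ^ 'a::finite \<Rightarrow> real ^ 'b::finite) \<Rightarrow> nat \<Rightarrow> ereal" where
  "tensor_linf_norm r R N =
     (SUP F \<in> {F. L_norm (linf_norm N) r F \<le> 1}.
        ereal (L_norm (linf_norm N) r (coordinatewise R F)))"

definition reg_norm :: "ereal \<Rightarrow> (real ^ 'a::finite \<Rightarrow> real ^ 'b::finite) \<Rightarrow> ereal" where
  "reg_norm r R = (SUP N \<in> {1..}. tensor_linf_norm r R N)"

definition regular_operator :: "ereal \<Rightarrow> (real ^ 'a::finite \<Rightarrow> real ^ 'b::finite) \<Rightarrow> bool" where
  "regular_operator r R \<longleftrightarrow> linear R \<and> reg_norm r R < \<infinity>"

definition conjugate_exponent :: "real \<Rightarrow> ereal" where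
  "conjugate_exponent p = (if p = 1 then \<infinity> else ereal (p / (p - 1)))"

end

theory Submission
  imports Defs
begin

text \<open>
  Both halves compare the two kinds of differences geometrically on the torus: a long difference
  \<open>f (x + m e\<^sub>j) - f x\<close> travels \<open>\<ell>\<^sub>\<infinity>\<close>-distance \<open>m\<close>, a sign difference \<open>f (x + \<epsilon>) - f x\<close> travels
  \<open>\<ell>\<^sub>\<infinity>\<close>-distance \<open>1\<close>, and \<open>m\<close> sign steps suffice for one long step.

  \<^bold>\<open>Lower bound\<close> (\<open>reg_norm_ge\<close>). The functions \<open>f\<^sub>z x = \<parallel>x - z\<parallel>\<close>, with the \<open>\<ell>\<^sub>\<infinity>\<close>-length of the
  torus, embed it isometrically in \<open>\<ell>\<^sub>\<infinity>\<close>: their sign differences are at most \<open>1\<close> in modulus, while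
  \<open>f\<^sub>z (z + m e\<^sub>j) - f\<^sub>z z = m\<close>. For each \<open>\<omega> = (x, \<epsilon>)\<close> take the scalar test function
  \<open>F\<^sub>\<omega> (y, j) = f\<^sub>y (x + \<epsilon>) - f\<^sub>y x\<close>. Together they form one function with values in the unit ball
  of \<open>\<ell>\<^sub>\<infinity>\<^sup>N\<close>, where \<open>N\<close> is the number of pairs \<open>\<omega>\<close>. Looking only at coordinate \<open>\<omega>\<close> over the
  point \<open>\<omega>\<close>, the mean of the diagonal values \<open>(S F\<^sub>\<omega>) \<omega>\<close> bounds the norm of the image from below.
  Writing \<open>F\<^sub>\<omega>\<close> as a combination of the indicators of \<open>y = z\<close> and moving the sign differences of
  \<open>f\<^sub>z\<close> to the other side of the duality turns \<open>S\<close> into the adjoint of the sign differences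
  composed with \<open>S\<close>, which is the scaled adjoint of the long differences. So the mean does not depend
  on \<open>S\<close> and can be computed: it is \<open>n powr (1/q)\<close>.

  \<^bold>\<open>Attainment\<close> (\<open>D_sgn_adj_path_average\<close>, \<open>reg_norm_path_average_le\<close>). Let \<open>\<epsilon>'\<close> agree with
  \<open>\<epsilon>\<close> at \<open>j\<close> and have all other signs reversed. Then \<open>\<epsilon> + \<epsilon>' = 2 \<epsilon>\<^sub>j e\<^sub>j\<close>, so for even \<open>m\<close> the
  \<open>m\<close> alternating steps \<open>\<epsilon>, \<epsilon>', \<epsilon>, \<epsilon>', \<dots>\<close> lead from \<open>x\<close> to \<open>x + m \<epsilon>\<^sub>j e\<^sub>j = x + m e\<^sub>j\<close>. Averaging
  over \<open>\<epsilon>\<close> expresses long differences through sign differences; the adjoint of this expression is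
  \<open>n powr (1/q)\<close> times an average of compositions with translations. Under all of these together
  the uniform measure is preserved, so by Jensen's inequality such an average is a contraction on
  \<open>L\<^sub>r\<close> with values in any \<open>\<ell>\<^sub>\<infinity>\<^sup>N\<close> (\<open>reg_norm_average_le\<close>).
\<close>

section \<open>Power means and the norms\<close>

text \<open>
  Moduli of function values may vanish, so the convexity of powers is needed at the end point \<open>0\<close> as
  well; there it reduces to \<open>t powr s \<le> t\<close> for \<open>0 \<le> t \<le> 1\<close>.
\<close>

lemma powr_convex_nonneg:
  assumes "(1::real) \<le> s"
  shows "convex_on {0..} (\<lambda>x. x powr s)"
proof (rule convex_onI)
  have scale: "(t * y) powr s \<le> t * y powr s" if "0 \<le> t" "t \<le> 1" "0 \<le> y" for t y :: real
  proof -
    have "t powr s \<le> t"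
    proof (cases "t = 0")
      case False
      then have "t powr s \<le> t powr 1"
        using that assms by (intro powr_mono') auto
      then show ?thesis
        using that False by simp
    qed simp
    then show ?thesis
      using that by (simp add: powr_mult mult_right_mono)
  qed
  fix t x y :: real
  assume t: "0 < t" "t < 1" and xy: "x \<in> {0..}" "y \<in> {0..}"
  consider "x = 0" | "y = 0" | "0 < x" "0 < y"
    using xy by fastforce
  then show "((1 - t) *\<^sub>R x + t *\<^sub>R y) powr s \<le> (1 - t) * x powr s + t * y powr s"
  proof cases
    case 1
    then show ?thesis using scale[of t y] t xy by simp
  next
    case 2
    then show ?thesis using scale[of "1 - t" x] t xy by simp
  next
    case 3
    then show ?thesis
      using convex_onD[OF powr_convex[OF assms], of t x y] t by simp
  qed
qed simp

lemma mean_powr_le: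
  fixes a :: "'k \<Rightarrow> real"
  assumes "1 \<le> s" "finite K" "K \<noteq> {}" "\<And>k. k \<in> K \<Longrightarrow> 0 \<le> a k"
  shows "((\<Sum>k\<in>K. a k) / real (card K)) powr s \<le> (\<Sum>k\<in>K. a k powr s) / real (card K)"
  using convex_on_sum[OF assms(2,3) powr_convex_nonneg[OF assms(1)], of "\<lambda>_. 1 / real (card K)" a]
    assms by (simp add: sum_divide_distrib)

lemma mean_le_L_norm:
  fixes F :: "'w::finite \<Rightarrow> 'y"
  assumes "1 \<le> r" "\<And>v. 0 \<le> norm_Y v"
  shows "(\<Sum>\<omega>\<in>UNIV. norm_Y (F \<omega>)) / real CARD('w) \<le> L_norm norm_Y r F"
proof (cases r)
  case (real s)
  then have s: "1 \<le> s" using assms(1) by simp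
  let ?A = "(\<Sum>\<omega>\<in>UNIV. norm_Y (F \<omega>)) / real CARD('w)"
  have "?A powr s \<le> (\<Sum>\<omega>\<in>UNIV. norm_Y (F \<omega>) powr s) / real CARD('w)"
    using mean_powr_le[OF s, of UNIV "\<lambda>\<omega>. norm_Y (F \<omega>)"] assms(2) by simp
  then have "(?A powr s) powr (1/s)
      \<le> ((\<Sum>\<omega>\<in>UNIV. norm_Y (F \<omega>) powr s) / real CARD('w)) powr (1/s)"
    using s by (intro powr_mono2) auto
  moreover have "(?A powr s) powr (1/s) = ?A"
    using s assms(2) by (simp add: powr_powr sum_nonneg)
  ultimately show ?thesis using real by (simp add: L_norm_def)
next
  case PInf
  have "(\<Sum>\<omega>\<in>UNIV. norm_Y (F \<omega>))
      \<le> of_nat (card (UNIV :: 'w set)) * Max (range (\<lambda>\<omega>. norm_Y (F \<omega>)))"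
    by (rule sum_bounded_above) (auto intro: Max_ge)
  then show ?thesis using PInf by (simp add: L_norm_def field_simps)
next
  case MInf
  then show ?thesis using assms(1) by simp
qed

lemma L_norm_le_1:
  fixes F :: "'w::finite \<Rightarrow> 'y"
  assumes "1 \<le> r" "\<And>v. 0 \<le> norm_Y v" "\<And>\<omega>. norm_Y (F \<omega>) \<le> 1"
  shows "L_norm norm_Y r F \<le> 1"
proof (cases r)
  case (real s)
  then have s: "1 \<le> s" using assms(1) by simp
  have "(\<Sum>\<omega>\<in>UNIV. norm_Y (F \<omega>) powr s) \<le> of_nat (card (UNIV :: 'w set)) * 1"
    using assms s by (intro sum_bounded_above) (auto intro: powr_le1)
  then have "((1 / real CARD('w)) * (\<Sum>\<omega>\<in>UNIV. norm_Y (F \<omega>) powr s)) powr (1/s) \<le> 1"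
    using s by (intro powr_le1) (auto intro!: divide_nonneg_nonneg sum_nonneg simp: divide_le_eq_1 abs_of_nonneg sum_nonneg)
  then show ?thesis using real by (simp add: L_norm_def)
next
  case PInf
  then show ?thesis using assms by (simp add: L_norm_def)
next
  case MInf
  then show ?thesis using assms(1) by simp
qed

lemma linf_norm_ge: "i < N \<Longrightarrow> \<bar>v i\<bar> \<le> linf_norm N v"
  by (auto simp: linf_norm_def intro: Max_ge)

lemma linf_norm_leI: "1 \<le> N \<Longrightarrow> (\<And>i. i < N \<Longrightarrow> \<bar>v i\<bar> \<le> c) \<Longrightarrow> linf_norm N v \<le> c"
  unfolding linf_norm_def by (subst Max_le_iff) (auto simp: lessThan_empty_iff)

lemma linf_norm_nonneg: "1 \<le> N \<Longrightarrow> 0 \<le> linf_norm N v"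
  using linf_norm_ge[of 0 N v] by simp

lemma le_reg_norm:
  assumes "1 \<le> N" "L_norm (linf_norm N) r F \<le> 1"
  shows "ereal (L_norm (linf_norm N) r (coordinatewise R F)) \<le> reg_norm r R"
  unfolding reg_norm_def tensor_linf_norm_def
  using assms by (intro SUP_upper2[of N] SUP_upper2[of F]) auto

section \<open>Averages over measure-preserving maps\<close>

text \<open>
  A single map \<open>\<tau> k\<close> may reach only a part of the domain (a fixed direction \<open>j\<close>, say); Jensen's
  inequality needs only that the maps push the uniform measure forward to the uniform measure after
  averaging over \<open>k\<close>. Positivity of the averaging is what makes the bound independent of \<open>N\<close>: the
  \<open>\<ell>\<^sub>\<infinity>\<close>-norm of the average is at most the average of the \<open>\<ell>\<^sub>\<infinity>\<close>-norms, and from then on the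
  argument is scalar.
\<close>

lemma reg_norm_average_le:
  fixes \<tau> :: "'k \<Rightarrow> 'b::finite \<Rightarrow> 'a::finite" and R :: "real ^ 'a \<Rightarrow> real ^ 'b"
  assumes r: "1 \<le> r" and K: "finite K" "K \<noteq> {}" and c: "0 \<le> c"
    and R: "\<And>g \<omega>. R g $ \<omega> = c * ((\<Sum>k\<in>K. g $ \<tau> k \<omega>) / real (card K))"
    and preserve: "\<And>u :: 'a \<Rightarrow> real.
      (\<Sum>k\<in>K. \<Sum>\<omega>\<in>UNIV. u (\<tau> k \<omega>)) / (real (card K) * real CARD('b)) = (\<Sum>\<eta>\<in>UNIV. u \<eta>) / real CARD('a)"
  shows "reg_norm r R \<le> ereal c"
proof -
  have main: "L_norm (linf_norm N) r (coordinatewise R F) \<le> c"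
    if N: "1 \<le> N" and F: "L_norm (linf_norm N) r F \<le> 1" for N F
  proof -
    let ?G = "coordinatewise R F"
    let ?a = "\<lambda>\<eta>. linf_norm N (F \<eta>)"
    have a: "0 \<le> ?a \<eta>" for \<eta> using linf_norm_nonneg[OF N] .
    have K0: "0 < real (card K)" using K by (simp add: card_gt_0_iff)
    have pt: "linf_norm N (?G \<omega>) \<le> c * ((\<Sum>k\<in>K. ?a (\<tau> k \<omega>)) / real (card K))" for \<omega>
    proof (rule linf_norm_leI[OF N])
      fix i assume i: "i < N"
      have "\<bar>\<Sum>k\<in>K. F (\<tau> k \<omega>) i\<bar> \<le> (\<Sum>k\<in>K. ?a (\<tau> k \<omega>))"
        by (rule order_trans[OF sum_abs]) (intro sum_mono linf_norm_ge i)
      then show "\<bar>?G \<omega> i\<bar> \<le> c * ((\<Sum>k\<in>K. ?a (\<tau> k \<omega>)) / real (card K))"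
        using c K0 by (simp add: coordinatewise_def R abs_mult divide_right_mono mult_left_mono)
    qed
    show ?thesis
    proof (cases r)
      case (real s)
      then have s: "1 \<le> s" using r by simp
      let ?M = "\<Sum>\<eta>\<in>UNIV. ?a \<eta> powr s"
      have "linf_norm N (?G \<omega>) powr s
          \<le> c powr s * ((\<Sum>k\<in>K. ?a (\<tau> k \<omega>) powr s) / real (card K))" for \<omega>
      proof -
        have "linf_norm N (?G \<omega>) powr s \<le> (c * ((\<Sum>k\<in>K. ?a (\<tau> k \<omega>)) / real (card K))) powr s"
          using s by (intro powr_mono2 pt linf_norm_nonneg[OF N]) auto
        also have "\<dots> = c powr s * ((\<Sum>k\<in>K. ?a (\<tau> k \<omega>)) / real (card K)) powr s"
          using c a by (intro powr_mult)
        also have "\<dots> \<le> c powr s * ((\<Sum>k\<in>K. ?a (\<tau> k \<omega>) powr s) / real (card K))"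
          using mean_powr_le[OF s K, of "\<lambda>k. ?a (\<tau> k \<omega>)"] a by (intro mult_left_mono) auto
        finally show ?thesis .
      qed
      then have "(\<Sum>\<omega>\<in>UNIV. linf_norm N (?G \<omega>) powr s)
          \<le> (\<Sum>\<omega>\<in>UNIV. c powr s * ((\<Sum>k\<in>K. ?a (\<tau> k \<omega>) powr s) / real (card K)))"
        by (intro sum_mono)
      also have "\<dots> = c powr s / real (card K) * (\<Sum>k\<in>K. \<Sum>\<omega>\<in>UNIV. ?a (\<tau> k \<omega>) powr s)"
        by (subst sum.swap) (simp add: sum_distrib_left sum_divide_distrib)
      finally have sums: "(\<Sum>\<omega>\<in>UNIV. linf_norm N (?G \<omega>) powr s)
          \<le> c powr s / real (card K) * (\<Sum>k\<in>K. \<Sum>\<omega>\<in>UNIV. ?a (\<tau> k \<omega>) powr s)" .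
      have "(\<Sum>\<omega>\<in>UNIV. linf_norm N (?G \<omega>) powr s) / real CARD('b)
          \<le> c powr s * ((\<Sum>k\<in>K. \<Sum>\<omega>\<in>UNIV. ?a (\<tau> k \<omega>) powr s) / (real (card K) * real CARD('b)))"
        using divide_right_mono[OF sums, of "real CARD('b)"] by simp
      also have "\<dots> = c powr s * (?M / real CARD('a))"
        by (simp only: preserve[of "\<lambda>\<eta>. ?a \<eta> powr s"])
      finally have "((\<Sum>\<omega>\<in>UNIV. linf_norm N (?G \<omega>) powr s) / real CARD('b)) powr (1/s)
          \<le> (c powr s * (?M / real CARD('a))) powr (1/s)"
        using s by (intro powr_mono2) (auto intro!: divide_nonneg_nonneg sum_nonneg)
      also have "\<dots> = c * (?M / real CARD('a)) powr (1/s)"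
        proof -
        have "(c powr s * (?M / real CARD('a))) powr (1/s)
            = (c powr s) powr (1/s) * (?M / real CARD('a)) powr (1/s)"
          by (rule powr_mult)
        then show ?thesis
          using s c by (simp add: powr_powr)
      qed
      also have "\<dots> \<le> c * 1"
        using F c real by (intro mult_left_mono) (auto simp: L_norm_def)
      finally show ?thesis using real by (simp add: L_norm_def)
    next
      case PInf
      have a1: "?a \<eta> \<le> 1" for \<eta>
        using F PInf by (simp add: L_norm_def)
      have "linf_norm N (?G \<omega>) \<le> c" for \<omega>
      proof -
        have "(\<Sum>k\<in>K. ?a (\<tau> k \<omega>)) \<le> of_nat (card K) * 1"
          by (intro sum_bounded_above a1)
        then have "c * ((\<Sum>k\<in>K. ?a (\<tau> k \<omega>)) / real (card K)) \<le> c * 1"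
          using c K0 by (intro mult_left_mono) (auto simp: field_simps)
        then show ?thesis using pt[of \<omega>] by simp
      qed
      then show ?thesis using PInf by (simp add: L_norm_def)
    next
      case MInf
      then show ?thesis using r by simp
    qed
  qed
  then show ?thesis
    unfolding reg_norm_def tensor_linf_norm_def by (intro SUP_least) auto
qed

section \<open>Length functions on the discrete torus\<close>

lemma of_nat_double_card_bit0: "of_nat (2 * CARD('m::finite)) = (0 :: 'm bit0)"
  using of_nat_CHAR[where 'a = "'m bit0"] by simp

lemma minus_half_turn: "- of_nat CARD('m::finite) = (of_nat CARD('m) :: 'm bit0)"
  using of_nat_double_card_bit0[where 'm = 'm] by (simp add: minus_unique)

text \<open>
  The distance to \<open>0\<close> in the cyclic group, as the least modulus of an integer representative. In this
  form the Lipschitz property below needs no case distinction on where a representative wraps around.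
\<close>

definition circle_length :: "'m::finite bit0 \<Rightarrow> nat" where
  "circle_length a = (LEAST k. \<exists>z. of_int z = a \<and> nat \<bar>z\<bar> = k)"

lemma circle_length_le: "of_int z = a \<Longrightarrow> circle_length a \<le> nat \<bar>z\<bar>"
  unfolding circle_length_def by (rule Least_le) auto

lemma circle_length_attained:
  obtains z where "of_int z = a" "nat \<bar>z\<bar> = circle_length a"
proof -
  obtain z0 where "of_int z0 = a" by (cases a) auto
  then have "\<exists>z. of_int z = a \<and> nat \<bar>z\<bar> = circle_length a"
    unfolding circle_length_def
    using LeastI_ex[of "\<lambda>k. \<exists>z. of_int z = a \<and> nat \<bar>z\<bar> = k"] by blast
  then show ?thesis using that by blast
qed

lemma circle_length_0 [simp]: "circle_length 0 = 0"
  using circle_length_le[of 0 0] by simp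

text \<open>
  Every representative of \<open>m\<close> modulo \<open>2m\<close> is an odd multiple of \<open>m\<close>, hence at least \<open>m\<close> in
  modulus.
\<close>

lemma circle_length_half_turn: "circle_length (of_nat CARD('m) :: 'm::finite bit0) = CARD('m)"
proof (rule antisym)
  show "circle_length (of_nat CARD('m) :: 'm bit0) \<le> CARD('m)"
    using circle_length_le[of "int CARD('m)" "of_nat CARD('m) :: 'm bit0"] by simp
  obtain z where z: "of_int z = (of_nat CARD('m) :: 'm bit0)"
    and len: "nat \<bar>z\<bar> = circle_length (of_nat CARD('m) :: 'm bit0)"
    using circle_length_attained by blast
  have "of_int (z - int CARD('m)) = (0 :: 'm bit0)"
    using z by simp
  then have "2 * int CARD('m) dvd z - int CARD('m)"
    by (simp only: of_int_eq_0_iff_char_dvd bit0.CHAR_eq card_bit0) simp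
  then obtain k where "z = int CARD('m) * (2 * k + 1)"
    by (auto simp: dvd_def algebra_simps)
  then have "\<bar>z\<bar> = int CARD('m) * \<bar>2 * k + 1\<bar>"
    by (simp add: abs_mult)
  moreover have "1 \<le> \<bar>2 * k + 1\<bar>" by presburger
  ultimately have "int CARD('m) \<le> \<bar>z\<bar>"
    by (simp add: mult_le_cancel_left1)
  then show "CARD('m) \<le> circle_length (of_nat CARD('m) :: 'm bit0)"
    using len by linarith
qed

lemma circle_length_shift_le: "circle_length (a + of_int s) \<le> circle_length a + nat \<bar>s\<bar>"
proof -
  obtain z where "of_int z = a" "nat \<bar>z\<bar> = circle_length a"
    by (rule circle_length_attained)
  moreover have "nat \<bar>z + s\<bar> \<le> nat \<bar>z\<bar> + nat \<bar>s\<bar>" by linarith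
  ultimately show ?thesis
    using circle_length_le[of "z + s" "a + of_int s"] by simp
qed

definition torus_length :: "('m::finite, 'n::finite) torus \<Rightarrow> nat" where
  "torus_length x = Max (range (\<lambda>i. circle_length (x $ i)))"

lemma circle_length_le_torus_length: "circle_length (x $ i) \<le> torus_length x"
  unfolding torus_length_def by (rule Max_ge) auto

lemma torus_length_leI: "(\<And>i. circle_length (x $ i) \<le> k) \<Longrightarrow> torus_length x \<le> k"
  unfolding torus_length_def by (subst Max_le_iff) auto

lemma torus_length_0 [simp]: "torus_length 0 = 0"
  using torus_length_leI[of 0 0] by simp

lemma torus_length_half_turn:
  "torus_length (axis j (of_nat CARD('m)) :: ('m::finite, 'n::finite) torus) = CARD('m)"
proof (rule antisym)
  show "torus_length (axis j (of_nat CARD('m)) :: ('m, 'n) torus) \<le> CARD('m)"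
    by (rule torus_length_leI) (simp add: axis_def circle_length_half_turn)
  show "CARD('m) \<le> torus_length (axis j (of_nat CARD('m)) :: ('m, 'n) torus)"
    using circle_length_le_torus_length[of "axis j (of_nat CARD('m)) :: ('m, 'n) torus" j]
    by (simp add: circle_length_half_turn)
qed

lemma abs_Rep_pm_one [simp]: "\<bar>Rep_pm_one s\<bar> = 1"
  using Rep_pm_one[of s] by auto

text \<open>
  A sign vector moves all coordinates at once; the maximum over the coordinates is the length for
  which this still costs only one unit.
\<close>

lemma torus_length_sign_shift:
  "\<bar>real (torus_length (x + sign_shift \<epsilon>)) - real (torus_length x)\<bar> \<le> 1"
proof -
  have "torus_length (x + sign_shift \<epsilon>) \<le> torus_length x + 1"
  proof (rule torus_length_leI)
    fix i
    have "circle_length ((x + sign_shift \<epsilon>) $ i) \<le> circle_length (x $ i) + 1"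
      using circle_length_shift_le[of "x $ i" "Rep_pm_one (\<epsilon> $ i)"] by (simp add: sign_shift_def)
    also have "\<dots> \<le> torus_length x + 1"
      by (simp add: circle_length_le_torus_length)
    finally show "circle_length ((x + sign_shift \<epsilon>) $ i) \<le> torus_length x + 1" .
  qed
  moreover have "torus_length x \<le> torus_length (x + sign_shift \<epsilon>) + 1"
  proof (rule torus_length_leI)
    fix i
    have "circle_length (x $ i) \<le> circle_length ((x + sign_shift \<epsilon>) $ i) + 1"
      using circle_length_shift_le[of "(x + sign_shift \<epsilon>) $ i" "- Rep_pm_one (\<epsilon> $ i)"]
      by (simp add: sign_shift_def)
    also have "\<dots> \<le> torus_length (x + sign_shift \<epsilon>) + 1"
      by (simp only: add_le_cancel_right circle_length_le_torus_length)
    finally show "circle_length (x $ i) \<le> torus_length (x + sign_shift \<epsilon>) + 1" .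
  qed
  ultimately show ?thesis by linarith
qed

section \<open>The lower bound\<close>

lemma sum_shift: "(\<Sum>x\<in>UNIV. u (x - v)) = (\<Sum>x\<in>UNIV. u (x :: 'g::{finite,ab_group_add}))"
  by (rule sum.reindex_bij_witness[of _ "\<lambda>x. x + v" "\<lambda>x. x - v"]) auto

lemma sum_mult_shift_diff:
  fixes u w :: "'g::{finite,ab_group_add} \<Rightarrow> real"
  shows "(\<Sum>x\<in>UNIV. u x * (w (x - v) - w x)) = (\<Sum>x\<in>UNIV. (u (x + v) - u x) * w x)"
  using sum_shift[of "\<lambda>x. u (x + v) * w x" v]
  by (simp add: algebra_simps sum_subtractf)

lemma sum_mult_D_sgn_adj:
  fixes h :: "real ^ (('m::finite, 'n::finite) torus \<times> 'n signs)"
  shows "(\<Sum>x\<in>UNIV. f x * D_sgn_adj h $ x)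
    = (\<Sum>(x, \<epsilon>)\<in>UNIV. (f (x + sign_shift \<epsilon>) - f x) * h $ (x, \<epsilon>)) / 2 ^ CARD('n)"
proof -
  have "(\<Sum>x\<in>UNIV. f x * D_sgn_adj h $ x)
      = (\<Sum>x\<in>UNIV. \<Sum>\<epsilon>\<in>UNIV. f x * (h $ (x - sign_shift \<epsilon>, \<epsilon>) - h $ (x, \<epsilon>))) / 2 ^ CARD('n)"
    by (simp add: D_sgn_adj_def sum_divide_distrib sum_distrib_left)
  also have "(\<Sum>x\<in>UNIV. \<Sum>\<epsilon>\<in>UNIV. f x * (h $ (x - sign_shift \<epsilon>, \<epsilon>) - h $ (x, \<epsilon>)))
      = (\<Sum>\<epsilon>\<in>UNIV. \<Sum>x\<in>UNIV. (f (x + sign_shift \<epsilon>) - f x) * h $ (x, \<epsilon>))"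
    by (subst sum.swap) (intro sum.cong refl sum_mult_shift_diff[where w = "\<lambda>x. h $ (x, _)"])
  finally show ?thesis
    by (subst (asm) sum.swap) (simp add: sum.cartesian_product)
qed

lemma sum_mult_D_long_adj:
  fixes g :: "real ^ (('m::finite, 'n::finite) torus \<times> 'n)"
  shows "(\<Sum>x\<in>UNIV. f x * D_long_adj g $ x)
    = (\<Sum>(x, j)\<in>UNIV. (f (x + axis j (of_nat CARD('m))) - f x) * g $ (x, j)) / real CARD('n)"
proof -
  have "(\<Sum>x\<in>UNIV. f x * D_long_adj g $ x)
      = (\<Sum>x\<in>UNIV. \<Sum>j\<in>UNIV. f x * (g $ (x - axis j (of_nat CARD('m)), j) - g $ (x, j)))
          / real CARD('n)"
    by (simp add: D_long_adj_def sum_divide_distrib sum_distrib_left)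
  also have "(\<Sum>x\<in>UNIV. \<Sum>j\<in>UNIV. f x * (g $ (x - axis j (of_nat CARD('m)), j) - g $ (x, j)))
      = (\<Sum>j\<in>UNIV. \<Sum>x\<in>UNIV. (f (x + axis j (of_nat CARD('m))) - f x) * g $ (x, j))"
    by (subst sum.swap) (intro sum.cong refl sum_mult_shift_diff[where w = "\<lambda>x. g $ (x, _)"])
  finally show ?thesis
    by (subst (asm) sum.swap) (simp add: sum.cartesian_product)
qed

lemma card_signs: "CARD('n::finite signs) = 2 ^ CARD('n)"
proof -
  have "CARD(pm_one) = 2"
    by (subst type_definition.card[OF type_definition_pm_one]) simp
  then show ?thesis by simp
qed

text \<open>
  The pairing of the slopes of the distance function based at \<open>z\<close> with the image of the indicator of
  \<open>z\<close> is determined by the intertwining relation alone; summed over \<open>z\<close> it is the sum of the diagonal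
  values of \<open>S\<close> on the test functions.
\<close>

lemma reg_norm_ge:
  fixes S :: "real ^ (('m::finite, 'n::finite) torus \<times> 'n) \<Rightarrow> real ^ (('m, 'n) torus \<times> 'n signs)"
  assumes r: "1 \<le> r" and lin: "linear S" and S: "D_sgn_adj \<circ> S = Dq_long_adj q"
  shows "ereal (real CARD('n) powr (1 / q)) \<le> reg_norm r S"
proof -
  define spike :: "('m, 'n) torus \<Rightarrow> real ^ (('m, 'n) torus \<times> 'n)"
    where "spike z = (\<chi> \<eta>. if fst \<eta> = z then 1 else 0)" for z
  define slope :: "('m, 'n) torus \<Rightarrow> ('m, 'n) torus \<times> 'n signs \<Rightarrow> real"
    where "slope z = (\<lambda>(x, \<epsilon>). real (torus_length (x + sign_shift \<epsilon> - z)) - real (torus_length (x - z)))"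
    for z
  let ?c = "real CARD('n) powr (1 / q)"
  have slope: "\<bar>slope z \<omega>\<bar> \<le> 1" for z \<omega>
    using torus_length_sign_shift[of "fst \<omega> - z" "snd \<omega>"]
    by (simp add: slope_def split_beta algebra_simps)
  \<comment> \<open>Summation by parts leaves only the value of the long difference at the spike, where the
    distance function rises from \<open>0\<close> to \<open>m\<close> in every direction.\<close>
  have pairing: "(\<Sum>\<omega>\<in>UNIV. slope z \<omega> * S (spike z) $ \<omega>) = 2 ^ CARD('n) * ?c" for z
  proof -
    let ?f = "\<lambda>x. real (torus_length (x - z))"
    have "(\<Sum>\<omega>\<in>UNIV. slope z \<omega> * S (spike z) $ \<omega>) / 2 ^ CARD('n)
        = (\<Sum>x\<in>UNIV. ?f x * D_sgn_adj (S (spike z)) $ x)"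
      unfolding sum_mult_D_sgn_adj by (simp add: slope_def split_beta)
    also have "D_sgn_adj (S (spike z)) = Dq_long_adj q (spike z)"
      using S by (metis comp_apply)
    also have "(\<Sum>x\<in>UNIV. ?f x * Dq_long_adj q (spike z) $ x)
        = ?c / real CARD('m) * (\<Sum>x\<in>UNIV. ?f x * D_long_adj (spike z) $ x)"
      by (simp add: Dq_long_adj_def sum_distrib_left algebra_simps)
    also have "(\<Sum>x\<in>UNIV. ?f x * D_long_adj (spike z) $ x) = real CARD('m)"
    proof -
      have "(\<Sum>(x, j)\<in>UNIV. (?f (x + axis j (of_nat CARD('m))) - ?f x) * spike z $ (x, j))
          = (\<Sum>j\<in>UNIV. \<Sum>x\<in>UNIV. (?f (x + axis j (of_nat CARD('m))) - ?f x) * spike z $ (x, j))"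
        by (subst sum.swap) (simp add: sum.cartesian_product)
      also have "\<dots> = (\<Sum>j\<in>(UNIV::'n set). real CARD('m))"
        by (intro sum.cong refl)
          (simp add: spike_def if_distrib[of "\<lambda>y. _ * y"] torus_length_half_turn cong: if_cong)
      finally show ?thesis unfolding sum_mult_D_long_adj by simp
    qed
    finally show ?thesis by (simp add: field_simps)
  qed
  define test :: "('m, 'n) torus \<times> 'n signs \<Rightarrow> real ^ (('m, 'n) torus \<times> 'n)"
    where "test \<omega> = (\<chi> \<eta>. slope (fst \<eta>) \<omega>)" for \<omega>
  have test: "test \<omega> = (\<Sum>z\<in>UNIV. slope z \<omega> *\<^sub>R spike z)" for \<omega>
  proof -
    have "test \<omega> $ \<eta> = (\<Sum>z\<in>UNIV. slope z \<omega> *\<^sub>R spike z) $ \<eta>" for \<eta>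
      by (simp add: test_def spike_def if_distrib[of "\<lambda>y. _ * y"] cong: if_cong)
    then show ?thesis unfolding vec_eq_iff by blast
  qed
  have "(\<Sum>\<omega>\<in>UNIV. S (test \<omega>) $ \<omega>) = (\<Sum>z\<in>UNIV. \<Sum>\<omega>\<in>UNIV. slope z \<omega> * S (spike z) $ \<omega>)"
    by (subst sum.swap) (simp add: test linear_sum[OF lin] linear_scale[OF lin])
  also have "\<dots> = real CARD(('m, 'n) torus \<times> 'n signs) * ?c"
    by (simp add: pairing card_signs del: CARD_vec)
  finally have total: "(\<Sum>\<omega>\<in>UNIV. S (test \<omega>) $ \<omega>) = real CARD(('m, 'n) torus \<times> 'n signs) * ?c" .

  define N where "N = CARD(('m, 'n) torus \<times> 'n signs)"
  have N: "1 \<le> N" unfolding N_def by (simp add: Suc_le_eq del: CARD_vec)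
  obtain e :: "nat \<Rightarrow> ('m, 'n) torus \<times> 'n signs" where e: "bij_betw e {0..<N} UNIV"
    using ex_bij_betw_nat_finite[of "UNIV :: (('m, 'n) torus \<times> 'n signs) set"] N_def by auto
  define F where "F = (\<lambda>\<eta> i. test (e i) $ \<eta>)"
  have "linf_norm N (F \<eta>) \<le> 1" for \<eta>
    by (intro linf_norm_leI N) (simp add: F_def test_def slope)
  then have F: "L_norm (linf_norm N) r F \<le> 1"
    by (intro L_norm_le_1 r linf_norm_nonneg N)
  have diag: "S (test \<omega>) $ \<omega> \<le> linf_norm N (coordinatewise S F \<omega>)" for \<omega>
  proof -
    have "\<omega> \<in> e ` {0..<N}"
      using e by (simp add: bij_betw_def)
    then obtain i where "i < N" "e i = \<omega>" by auto
    then show ?thesis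
      using linf_norm_ge[of i N "coordinatewise S F \<omega>"]
      by (simp add: coordinatewise_def F_def)
  qed
  have "?c = (\<Sum>\<omega>\<in>UNIV. S (test \<omega>) $ \<omega>) / real CARD(('m, 'n) torus \<times> 'n signs)"
    by (simp add: total del: CARD_vec)
  also have "\<dots> \<le> (\<Sum>\<omega>\<in>UNIV. linf_norm N (coordinatewise S F \<omega>)) / real CARD(('m, 'n) torus \<times> 'n signs)"
    by (intro divide_right_mono sum_mono diag) simp
  also have "\<dots> \<le> L_norm (linf_norm N) r (coordinatewise S F)"
    by (intro mean_le_L_norm r linf_norm_nonneg N)
  finally show ?thesis
    using le_reg_norm[OF N F, of S] by (meson ereal_less_eq(3) order_trans)
qed

section \<open>An extremal operator from alternating paths\<close>

text \<open>
  The partner of \<open>\<epsilon>\<close> in an alternating path in direction \<open>j\<close>: all signs except the one at \<open>j\<close> are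
  reversed, so that the two steps add up to \<open>2 \<epsilon>\<^sub>j e\<^sub>j\<close>.
\<close>

definition flip_off :: "'n::finite \<Rightarrow> 'n signs \<Rightarrow> 'n signs" where
  "flip_off j \<epsilon> = (\<chi> i. if i = j then \<epsilon> $ i else Abs_pm_one (- Rep_pm_one (\<epsilon> $ i)))"

lemma Rep_neg_pm_one: "Rep_pm_one (Abs_pm_one (- Rep_pm_one s)) = - Rep_pm_one s"
  using Rep_pm_one[of s] by (subst Abs_pm_one_inverse) auto

lemma flip_off_flip_off [simp]: "flip_off j (flip_off j \<epsilon>) = \<epsilon>"
  by (simp add: flip_off_def vec_eq_iff Rep_neg_pm_one Rep_pm_one_inverse)

lemma flip_off_same [simp]: "flip_off j \<epsilon> $ j = \<epsilon> $ j"
  by (simp add: flip_off_def)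

definition axis_multiple :: "nat \<Rightarrow> 'n::finite \<Rightarrow> 'n signs \<Rightarrow> ('m::finite, 'n) torus" where
  "axis_multiple k j \<epsilon> = axis j (of_int (int k * Rep_pm_one (\<epsilon> $ j)))"

lemma axis_multiple_flip_off [simp]: "axis_multiple k j (flip_off j \<epsilon>) = axis_multiple k j \<epsilon>"
  by (simp add: axis_multiple_def)

lemma axis_multiple_0 [simp]: "axis_multiple 0 j \<epsilon> = 0"
  by (simp add: axis_multiple_def)

text \<open>The sign of the direction is lost because \<open>- m = m\<close> modulo \<open>2m\<close>.\<close>

lemma axis_multiple_half_turn:
  "axis_multiple CARD('m) j \<epsilon> = (axis j (of_nat CARD('m)) :: ('m::finite, 'n::finite) torus)"
proof -
  have "Rep_pm_one (\<epsilon> $ j) = 1 \<or> Rep_pm_one (\<epsilon> $ j) = - 1"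
    using Rep_pm_one[of "\<epsilon> $ j"] by auto
  then show ?thesis
    by (auto simp: axis_multiple_def minus_half_turn)
qed

lemma sign_shift_flip_off:
  "sign_shift \<epsilon> + sign_shift (flip_off j \<epsilon>) = axis_multiple 2 j \<epsilon>"
  by (simp add: vec_eq_iff sign_shift_def flip_off_def axis_multiple_def axis_def Rep_neg_pm_one)

lemma axis_multiple_add: "axis_multiple (k + l) j \<epsilon> = axis_multiple k j \<epsilon> + axis_multiple l j \<epsilon>"
  by (simp add: axis_multiple_def vec_eq_iff axis_def distrib_right)

text \<open>
  Steps of the path are indexed by the direction \<open>j\<close>, the number \<open>i\<close> of completed pairs of steps, and
  the flag \<open>b\<close> telling the second step of a pair from the first. The offset is the displacement from
  the start of the path to the start of the step, expressed through the sign vector \<open>\<epsilon>\<close> of that very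
  step: the adjoint operator is evaluated at a given step, not at a given path. For a second step the
  path began with the partner of \<open>\<epsilon>\<close>, hence the offset \<open>2 i \<epsilon>\<^sub>j e\<^sub>j + (2 \<epsilon>\<^sub>j e\<^sub>j - \<epsilon>)\<close>.
\<close>

definition path_offset :: "'n::finite \<times> nat \<times> bool \<Rightarrow> 'n signs \<Rightarrow> ('m::finite, 'n) torus" where
  "path_offset = (\<lambda>(j, i, b) \<epsilon>.
     if b then axis_multiple (2 * i + 2) j \<epsilon> - sign_shift \<epsilon> else axis_multiple (2 * i) j \<epsilon>)"

definition path_steps :: "nat \<Rightarrow> ('n::finite \<times> nat \<times> bool) set" where
  "path_steps m = UNIV \<times> {..<m div 2} \<times> UNIV"

definition path_average ::
  "real \<Rightarrow> real ^ (('m::finite, 'n::finite) torus \<times> 'n) \<Rightarrow> real ^ (('m, 'n) torus \<times> 'n signs)" where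
  "path_average c g = (\<chi> \<omega>. c * ((\<Sum>k\<in>path_steps CARD('m).
      g $ (fst \<omega> - path_offset k (snd \<omega>), fst k)) / real (card (path_steps CARD('m) :: ('n \<times> nat \<times> bool) set))))"

lemma card_path_steps: "even m \<Longrightarrow> card (path_steps m :: ('n::finite \<times> nat \<times> bool) set) = CARD('n) * m"
  by (simp add: path_steps_def card_cartesian_product)

lemma sum_path_steps:
  "(\<Sum>k\<in>path_steps m. u k) = (\<Sum>j\<in>UNIV. \<Sum>i<m div 2. u (j, i, False) + u (j, i, True))"
  by (simp add: path_steps_def sum.cartesian_product' UNIV_bool add.commute)

text \<open>
  For fixed \<open>\<epsilon>\<close> and \<open>i\<close>, the first and the second step of the pair contribute two terms each. Those
  at points \<open>x - 2 i \<epsilon>\<^sub>j e\<^sub>j\<close> telescope in \<open>i\<close>. The remaining two lie at the midpoints of pairs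
  beginning with \<open>\<epsilon>\<close> and with its partner, so they cancel on summing over \<open>\<epsilon>\<close>.
\<close>

lemma path_telescopes:
  fixes u :: "('m::finite, 'n::finite) torus \<Rightarrow> real"
  assumes "even CARD('m)"
  shows "(\<Sum>\<epsilon>\<in>UNIV. \<Sum>i<CARD('m) div 2. \<Sum>b\<in>UNIV.
      u (x - sign_shift \<epsilon> - path_offset (j, i, b) \<epsilon>) - u (x - path_offset (j, i, b) \<epsilon>))
    = 2 ^ CARD('n) * (u (x - axis j (of_nat CARD('m))) - u x)"
proof -
  let ?A = "\<lambda>\<epsilon> k. u (x - axis_multiple k j \<epsilon>)"
  let ?B = "\<lambda>\<epsilon> i. u (x - axis_multiple (2 * i) j \<epsilon> - sign_shift \<epsilon>)"
  have step: "(\<Sum>b\<in>UNIV. u (x - sign_shift \<epsilon> - path_offset (j, i, b) \<epsilon>) - u (x - path_offset (j, i, b) \<epsilon>))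
      = (?A \<epsilon> (2 * Suc i) - ?A \<epsilon> (2 * i)) + (?B \<epsilon> i - ?B (flip_off j \<epsilon>) i)" for \<epsilon> i
  proof -
    have "sign_shift \<epsilon> - axis_multiple (2 * i + 2) j \<epsilon>
        = - axis_multiple (2 * i) j \<epsilon> - sign_shift (flip_off j \<epsilon>)"
      unfolding axis_multiple_add sign_shift_flip_off[symmetric] by (simp add: algebra_simps)
    then have "x + (sign_shift \<epsilon> - axis_multiple (2 * i + 2) j \<epsilon>)
        = x + (- axis_multiple (2 * i) j \<epsilon> - sign_shift (flip_off j \<epsilon>))"
      by (rule arg_cong)
    then have second: "x - path_offset (j, i, True) \<epsilon>
        = x - axis_multiple (2 * i) j (flip_off j \<epsilon>) - sign_shift (flip_off j \<epsilon>)"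
      by (simp only: path_offset_def prod.case if_True axis_multiple_flip_off diff_diff_eq2
          add_diff_eq add_uminus_conv_diff)
    have second_shifted: "x - sign_shift \<epsilon> - path_offset (j, i, True) \<epsilon>
        = x - axis_multiple (2 * Suc i) j \<epsilon>"
      by (simp add: path_offset_def)
    have first_shifted: "x - sign_shift \<epsilon> - path_offset (j, i, False) \<epsilon>
        = x - axis_multiple (2 * i) j \<epsilon> - sign_shift \<epsilon>"
      by (simp add: path_offset_def algebra_simps)
    have first: "x - path_offset (j, i, False) \<epsilon> = x - axis_multiple (2 * i) j \<epsilon>"
      by (simp add: path_offset_def)
    show ?thesis
      unfolding UNIV_bool by (simp add: second second_shifted first_shifted first)
  qed
  have tele: "(\<Sum>i<CARD('m) div 2. ?A \<epsilon> (2 * Suc i) - ?A \<epsilon> (2 * i))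
      = u (x - axis j (of_nat CARD('m))) - u x" for \<epsilon>
    using sum_lessThan_telescope[of "\<lambda>i. ?A \<epsilon> (2 * i)" "CARD('m) div 2"] assms
    by (simp add: axis_multiple_half_turn)
  have flip: "(\<Sum>\<epsilon>\<in>UNIV. ?B (flip_off j \<epsilon>) i) = (\<Sum>\<epsilon>\<in>UNIV. ?B \<epsilon> i)" for i
    by (rule sum.reindex_bij_witness[of _ "flip_off j" "flip_off j"]) auto
  have "(\<Sum>\<epsilon>\<in>UNIV. \<Sum>i<CARD('m) div 2. ?B \<epsilon> i - ?B (flip_off j \<epsilon>) i) = 0"
    by (subst sum.swap) (simp only: sum_subtractf flip diff_self sum.neutral_const)
  then show ?thesis
    unfolding step by (simp only: sum.distrib tele) (simp add: card_signs del: CARD_vec)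
qed

lemma D_sgn_adj_path_average:
  assumes "even CARD('m::finite)"
  shows "D_sgn_adj \<circ> path_average (real CARD('n) powr (1 / q))
    = (Dq_long_adj q :: real ^ (('m, 'n::finite) torus \<times> 'n) \<Rightarrow> _)"
proof
  fix g :: "real ^ (('m, 'n) torus \<times> 'n)"
  let ?c = "real CARD('n) powr (1 / q)"
  let ?d = "?c / (real CARD('n) * real CARD('m))"
  have P: "path_average ?c g $ (y, \<epsilon>)
      = ?d * (\<Sum>j\<in>UNIV. \<Sum>i<CARD('m) div 2. \<Sum>b\<in>UNIV. g $ (y - path_offset (j, i, b) \<epsilon>, j))" for y \<epsilon>
    by (simp add: path_average_def card_path_steps[OF assms] sum_path_steps UNIV_bool algebra_simps)
  have "(D_sgn_adj \<circ> path_average ?c) g $ x = Dq_long_adj q g $ x" for x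
  proof -
    have "(\<Sum>\<epsilon>\<in>UNIV. path_average ?c g $ (x - sign_shift \<epsilon>, \<epsilon>) - path_average ?c g $ (x, \<epsilon>))
        = ?d * (\<Sum>\<epsilon>\<in>UNIV. \<Sum>j\<in>UNIV. \<Sum>i<CARD('m) div 2. \<Sum>b\<in>UNIV.
            g $ (x - sign_shift \<epsilon> - path_offset (j, i, b) \<epsilon>, j) - g $ (x - path_offset (j, i, b) \<epsilon>, j))"
      unfolding P by (simp only: right_diff_distrib[symmetric] sum_subtractf[symmetric] sum_distrib_left[symmetric])
    also have "\<dots> = ?d * (\<Sum>j\<in>UNIV. 2 ^ CARD('n) *
        (g $ (x - axis j (of_nat CARD('m)), j) - g $ (x, j)))"
      by (subst sum.swap) (simp only: path_telescopes[OF assms, where u = "\<lambda>y. g $ (y, _)"])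
    finally show ?thesis
      by (simp add: D_sgn_adj_def Dq_long_adj_def D_long_adj_def sum_distrib_left[symmetric])
  qed
  then show "(D_sgn_adj \<circ> path_average ?c) g = Dq_long_adj q g"
    by (simp add: vec_eq_iff)
qed

lemma linear_path_average: "linear (path_average c)"
  by (rule linearI)
    (simp_all add: path_average_def vec_eq_iff sum.distrib sum_distrib_left add_divide_distrib
      sum_divide_distrib algebra_simps)

text \<open>
  For a fixed sign vector each step is a translation of the torus, and every direction occurs in the
  same number \<open>m\<close> of steps; so the uniform measure is preserved on average.
\<close>

lemma reg_norm_path_average_le:
  assumes "even CARD('m::finite)" "1 \<le> r" "0 \<le> c"
  shows "reg_norm r (path_average c ::
      real ^ (('m, 'n::finite) torus \<times> 'n) \<Rightarrow> real ^ (('m, 'n) torus \<times> 'n signs)) \<le> ereal c"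
proof (rule reg_norm_average_le[where K = "path_steps CARD('m)"
      and \<tau> = "\<lambda>k \<omega>. (fst \<omega> - path_offset k (snd \<omega>), fst k)"])
  show "finite (path_steps CARD('m) :: ('n \<times> nat \<times> bool) set)"
    by (simp add: path_steps_def)
  have "card (path_steps CARD('m) :: ('n \<times> nat \<times> bool) set) > 0"
    by (simp add: card_path_steps[OF assms(1)])
  then show "(path_steps CARD('m) :: ('n \<times> nat \<times> bool) set) \<noteq> {}"
    by force
  fix u :: "('m, 'n) torus \<times> 'n \<Rightarrow> real"
  have inner: "(\<Sum>\<omega>\<in>UNIV. u (fst \<omega> - path_offset k (snd \<omega>), fst k))
      = 2 ^ CARD('n) * (\<Sum>x\<in>UNIV. u (x, fst k))" for k :: "'n \<times> nat \<times> bool"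
  proof -
    have "(\<Sum>\<omega>\<in>UNIV. u (fst \<omega> - path_offset k (snd \<omega>), fst k))
        = (\<Sum>\<epsilon>\<in>UNIV. \<Sum>x\<in>UNIV. u (x - path_offset k \<epsilon>, fst k))"
      by (subst sum.swap) (simp add: sum.cartesian_product split_beta)
    also have "\<dots> = (\<Sum>\<epsilon>\<in>(UNIV :: 'n signs set). \<Sum>x\<in>UNIV. u (x, fst k))"
      by (simp only: sum_shift[of "\<lambda>x. u (x, fst k)"])
    finally show ?thesis by (simp add: card_signs del: CARD_vec)
  qed
  have "(\<Sum>k\<in>path_steps CARD('m). \<Sum>\<omega>\<in>UNIV. u (fst \<omega> - path_offset k (snd \<omega>), fst k))
      = 2 ^ CARD('n) * (\<Sum>j\<in>UNIV. \<Sum>i<CARD('m) div 2. 2 * (\<Sum>x\<in>UNIV. u (x, j)))"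
    by (simp only: inner sum_path_steps fst_conv sum_distrib_left[symmetric] mult_2)
  also have "\<dots> = 2 ^ CARD('n) * real CARD('m) * (\<Sum>j\<in>UNIV. \<Sum>x\<in>UNIV. u (x, j))"
    using assms(1) by (simp add: sum_distrib_left[symmetric] real_of_nat_div)
  also have "(\<Sum>j\<in>UNIV. \<Sum>x\<in>UNIV. u (x, j)) = (\<Sum>\<eta>\<in>UNIV. u \<eta>)"
    by (subst sum.swap) (simp add: sum.cartesian_product)
  finally show "(\<Sum>k\<in>path_steps CARD('m). \<Sum>\<omega>\<in>UNIV. u (fst \<omega> - path_offset k (snd \<omega>), fst k))
        / (real (card (path_steps CARD('m) :: ('n \<times> nat \<times> bool) set)) * real CARD(('m, 'n) torus \<times> 'n signs))
      = (\<Sum>\<eta>\<in>UNIV. u \<eta>) / real CARD(('m, 'n) torus \<times> 'n)"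
    by (simp add: card_path_steps[OF assms(1)] card_signs field_simps del: CARD_vec)
qed (use assms in \<open>simp_all add: path_average_def\<close>)

lemma one_le_conjugate_exponent: "1 \<le> p \<Longrightarrow> 1 \<le> conjugate_exponent p"
  by (auto simp: conjugate_exponent_def)

theorem corollary1p4:
  fixes p q :: real
  assumes "1 \<le> p" and "p \<le> q" and "even CARD('m::finite)"
  shows
    "(\<forall>S :: real ^ (('m, 'n::finite) torus \<times> 'n) \<Rightarrow> real ^ (('m, 'n) torus \<times> 'n signs).
        regular_operator (conjugate_exponent p) S \<and> D_sgn_adj \<circ> S = Dq_long_adj q
        \<longrightarrow> reg_norm (conjugate_exponent p) S \<ge> ereal (real CARD('n) powr (1 / q))) \<and>
     (\<exists>S :: real ^ (('m, 'n) torus \<times> 'n) \<Rightarrow> real ^ (('m, 'n) torus \<times> 'n signs).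
        regular_operator (conjugate_exponent p) S \<and> D_sgn_adj \<circ> S = Dq_long_adj q \<and>
        reg_norm (conjugate_exponent p) S = ereal (real CARD('n) powr (1 / q)))"
proof -
  let ?r = "conjugate_exponent p" and ?c = "real CARD('n) powr (1 / q)"
  let ?S = "path_average ?c :: real ^ (('m, 'n) torus \<times> 'n) \<Rightarrow> real ^ (('m, 'n) torus \<times> 'n signs)"
  note r = one_le_conjugate_exponent[OF assms(1)]
  have le: "reg_norm ?r ?S \<le> ereal ?c"
    using r by (intro reg_norm_path_average_le assms(3)) auto
  have eq: "D_sgn_adj \<circ> ?S = Dq_long_adj q"
    by (rule D_sgn_adj_path_average[OF assms(3)])
  have "regular_operator ?r ?S"
    using le linear_path_average by (auto simp: regular_operator_def)
  moreover have "reg_norm ?r ?S = ereal ?c"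
    using le reg_norm_ge[OF r linear_path_average eq] by (rule antisym)
  ultimately show ?thesis
    using eq reg_norm_ge[OF r] by (auto simp: regular_operator_def)
qed

end
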